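(* Let $m\geq 1$ be an integer, let $\boldsymbol{r}_{j}=(r_{1j},r_{2j})^{T}\in\mathbb{R}^{2}$ be given points and let $w_{j},d_{j}\in\mathbb{R}$ with $d_{j}\geq 0$ for $j=1,\ldots,m$. Consider the problem of finding all $(x_{1},x_{2})^{T}\in\mathbb{R}^{2}$ that $$ \text{minimize}\quad \max_{1\leq j\leq m}(|x_{1}-r_{1j}|+|x_{2}-r_{2j}|+w_{j}) $$ $$ \text{subject to}\quad |x_{1}-r_{1j}|+|x_{2}-r_{2j}|\leq d_{j},\quad j=1,\ldots,m. $$ Define \begin{align*} p_{1}&=\max_{1\leq j\leq m}(w_{j}+r_{1j}+r_{2j}), & p_{2}&=\max_{1\leq j\leq m}(w_{j}-r_{1j}+r_{2j}),\\ q_{1}&=\min_{1\leq j\leq m}(-w_{j}+r_{1j}+r_{2j}), & q_{2}&=\min_{1\leq j\leq m}(-w_{j}-r_{1j}+r_{2j}),\\ g_{1}&=\max_{1\leq j\leq m}(-d_{j}+r_{1j}+r_{2j}), & g_{2}&=\max_{1\leq j\leq m}(-d_{j}-r_{1j}+r_{2j}),\\ h_{1}&=\min_{1\leq j\leq m}(d_{j}+r_{1j}+r_{2j}), & h_{2}&=\min_{1\leq j\leq m}(d_{j}-r_{1j}+r_{2j}), \end{align*} and suppose that $$ \max(g_{1}-h_{1},\ g_{2}-h_{2})\leq 0. $$ Then the minimum value in the problem is equal to $$ \theta=\max\bigl((p_{1}-q_{1})/2,\ (p_{2}-q_{2})/2,\ p_{1}-h_{1},\ p_{2}-h_{2},\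 g_{1}-q_{1},\ g_{2}-q_{2}\bigr), $$ and all solutions (i.e. exactly the set of minimizers) are given by $$ x_{1}=(u_{1}-u_{2})/2,\qquad x_{2}=(u_{1}+u_{2})/2, $$ where $$ u_{i}=(1-\alpha)\max(g_{i},p_{i}-\theta)+\alpha\min(h_{i},q_{i}+\theta),\qquad i=1,2, $$ for all real $\alpha$ such that $0\leq\alpha\leq 1$.
   Context: All operations are in conventional real arithmetic. "Solutions" of the problem are the feasible points at which the minimum of the objective function over the feasible set is attained; the same parameter $\alpha$ is used for $i=1$ and $i=2$, and the solution set is obtained as $\alpha$ ranges over $[0,1]$. *)

theory Defs
  imports "HOL-Analysis.Analysis"
begin

definition rect_dist :: "real^2 \<Rightarrow> real^2 \<Rightarrow> real" where
  "rect_dist x y = \<bar>x $ 1 - y $ 1\<bar> + \<bar>x $ 2 - y $ 2\<bar>"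

definition location_objective ::
  "nat \<Rightarrow> (nat \<Rightarrow> real^2) \<Rightarrow> (nat \<Rightarrow> real) \<Rightarrow> real^2 \<Rightarrow> real" where
  "location_objective m r w x = (MAX j\<in>{1..m}. rect_dist x (r j) + w j)"

definition location_feasible ::
  "nat \<Rightarrow> (nat \<Rightarrow> real^2) \<Rightarrow> (nat \<Rightarrow> real) \<Rightarrow> (real^2) set" where
  "location_feasible m r d = {x. \<forall>j\<in>{1..m}. rect_dist x (r j) \<le> d j}"

definition location_solutions ::
  "nat \<Rightarrow> (nat \<Rightarrow> real^2) \<Rightarrow> (nat \<Rightarrow> real) \<Rightarrow> (nat \<Rightarrow> real) \<Rightarrow> (real^2) set" where
  "location_solutions m r w d =
     {x. is_arg_min (location_objective m r w) (\<lambda>y. y \<in> location_feasible m r d) x}"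

text \<open>The minimum is required to be attained at a feasible point, not merely to be an infimum.\<close>

definition location_min_value ::
  "nat \<Rightarrow> (nat \<Rightarrow> real^2) \<Rightarrow> (nat \<Rightarrow> real) \<Rightarrow> (nat \<Rightarrow> real) \<Rightarrow> real \<Rightarrow> bool" where
  "location_min_value m r w d v \<longleftrightarrow>
     v \<in> location_objective m r w ` location_feasible m r d \<and>
     (\<forall>x\<in>location_feasible m r d. v \<le> location_objective m r w x)"

end

theory Submission
  imports Defs
begin

text \<open>In the coordinates \<open>u1 = x1 + x2\<close>, \<open>u2 = x2 - x1\<close> the rectilinear distance becomes the maximum
  distance, so the feasible points of objective value at most \<open>v\<close> form the box
  \<open>max gi (pi - v) \<le> ui \<le> min hi (qi + v)\<close>. The least \<open>v\<close> for which both intervals are nonempty is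
  \<open>\<theta>\<close>, and for \<open>v = \<theta>\<close> one of the two intervals is a single point. The box is then a segment,
  which is why one parameter \<open>\<alpha>\<close> for both coordinates suffices.\<close>

text \<open>Since \<open>\<bar>a\<bar> + \<bar>b\<bar>\<close> is the larger of
  \<open>\<bar>a + b\<bar>\<close> and \<open>\<bar>a - b\<bar>\<close>, a rectilinear ball is a box
  in the rotated coordinates.\<close>

lemma rect_dist_le_iff:
  "rect_dist x y \<le> c \<longleftrightarrow>
     - c + y $ 1 + y $ 2 \<le> x $ 1 + x $ 2 \<and> x $ 1 + x $ 2 \<le> c + y $ 1 + y $ 2 \<and>
     - c - y $ 1 + y $ 2 \<le> x $ 2 - x $ 1 \<and> x $ 2 - x $ 1 \<le> c - y $ 1 + y $ 2"
  unfolding rect_dist_def by linarith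

lemma Ball_rect_dist_le_iff:
  assumes "finite J" "J \<noteq> {}"
  shows "(\<forall>j\<in>J. rect_dist x (r j) \<le> c j) \<longleftrightarrow>
     (MAX j\<in>J. - c j + r j $ 1 + r j $ 2) \<le> x $ 1 + x $ 2 \<and>
     x $ 1 + x $ 2 \<le> (MIN j\<in>J. c j + r j $ 1 + r j $ 2) \<and>
     (MAX j\<in>J. - c j - r j $ 1 + r j $ 2) \<le> x $ 2 - x $ 1 \<and>
     x $ 2 - x $ 1 \<le> (MIN j\<in>J. c j - r j $ 1 + r j $ 2)"
  using assms by (auto simp: rect_dist_le_iff)

lemma Max_rect_dist_le_iff:
  assumes "finite J" "J \<noteq> {}"
  shows "(MAX j\<in>J. rect_dist x (r j) + w j) \<le> v \<longleftrightarrow>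
     (MAX j\<in>J. w j + r j $ 1 + r j $ 2) - v \<le> x $ 1 + x $ 2 \<and>
     x $ 1 + x $ 2 \<le> (MIN j\<in>J. - w j + r j $ 1 + r j $ 2) + v \<and>
     (MAX j\<in>J. w j - r j $ 1 + r j $ 2) - v \<le> x $ 2 - x $ 1 \<and>
     x $ 2 - x $ 1 \<le> (MIN j\<in>J. - w j - r j $ 1 + r j $ 2) + v"
proof -
  have "(MAX j\<in>J. rect_dist x (r j) + w j) \<le> v \<longleftrightarrow> (\<forall>j\<in>J. rect_dist x (r j) \<le> v - w j)"
    using assms by (auto simp: le_diff_eq)
  \<comment> \<open>The level \<open>v\<close> does not depend on \<open>j\<close>; keeping it on
    the side of \<open>x\<close> leaves exactly the expressions under \<open>MAX\<close> and
    \<open>MIN\<close> that define \<open>p1\<close>, \<open>q1\<close>, \<open>p2\<close>,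
    \<open>q2\<close>.\<close>
  also have "\<dots> \<longleftrightarrow>
      (\<forall>j\<in>J. w j + r j $ 1 + r j $ 2 \<le> x $ 1 + x $ 2 + v) \<and>
      (\<forall>j\<in>J. x $ 1 + x $ 2 - v \<le> - w j + r j $ 1 + r j $ 2) \<and>
      (\<forall>j\<in>J. w j - r j $ 1 + r j $ 2 \<le> x $ 2 - x $ 1 + v) \<and>
      (\<forall>j\<in>J. x $ 2 - x $ 1 - v \<le> - w j - r j $ 1 + r j $ 2)"
    unfolding rect_dist_le_iff ball_conj_distrib[symmetric]
    by (intro ball_cong refl) (auto simp: algebra_simps)
  also have "\<dots> \<longleftrightarrow>
     (MAX j\<in>J. w j + r j $ 1 + r j $ 2) \<le> x $ 1 + x $ 2 + v \<and>
     x $ 1 + x $ 2 - v \<le> (MIN j\<in>J. - w j + r j $ 1 + r j $ 2) \<and>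
     (MAX j\<in>J. w j - r j $ 1 + r j $ 2) \<le> x $ 2 - x $ 1 + v \<and>
     x $ 2 - x $ 1 - v \<le> (MIN j\<in>J. - w j - r j $ 1 + r j $ 2)"
    using assms by simp
  finally show ?thesis by (simp add: diff_le_eq)
qed

lemma ex_convex_combination_iff:
  fixes a b :: real
  assumes "a \<le> b"
  shows "(\<exists>\<alpha>. 0 \<le> \<alpha> \<and> \<alpha> \<le> 1 \<and> s = (1 - \<alpha>) * a + \<alpha> * b) \<longleftrightarrow> a \<le> s \<and> s \<le> b"
  using closed_segment_eq_real_ivl1[OF assms] by (auto simp: closed_segment_def set_eq_iff)

text \<open>The coordinate whose interval is a point puts no condition on \<alpha>, so \<alpha> is
  free to fit the other one.\<close>

lemma ex_convex_combination_degenerate_box_iff: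
  fixes a1 b1 a2 b2 :: real
  assumes "a1 \<le> b1" "a2 \<le> b2" "a1 = b1 \<or> a2 = b2"
  shows "(\<exists>\<alpha>. 0 \<le> \<alpha> \<and> \<alpha> \<le> 1 \<and> s = (1 - \<alpha>) * a1 + \<alpha> * b1 \<and> t = (1 - \<alpha>) * a2 + \<alpha> * b2) \<longleftrightarrow>
    a1 \<le> s \<and> s \<le> b1 \<and> a2 \<le> t \<and> t \<le> b2"
  using assms(3)
proof
  assume "a1 = b1"
  then have "(1 - \<alpha>) * a1 + \<alpha> * b1 = b1" for \<alpha>
    by (simp add: algebra_simps)
  with ex_convex_combination_iff[OF assms(2), of t] \<open>a1 = b1\<close> show ?thesis by force
next
  assume "a2 = b2"
  then have "(1 - \<alpha>) * a2 + \<alpha> * b2 = b2" for \<alpha>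
    by (simp add: algebra_simps)
  with ex_convex_combination_iff[OF assms(1), of s] \<open>a2 = b2\<close> show ?thesis by force
qed

lemma vector2_eq_rotated_iff:
  "x = vector [(u1 - u2) / 2, (u1 + u2) / 2] \<longleftrightarrow> u1 = x $ 1 + x $ 2 \<and> u2 = x $ 2 - (x $ 1 :: real)"
  for x :: "real^2"
  by (auto simp: vec_eq_iff forall_2)

text \<open>Because \<open>v\<close> is attained at a feasible point, no minimizer can exceed it;
  this turns the solution set into a sublevel set.\<close>

lemma location_solutions_eq:
  assumes "location_min_value m r w d v"
  shows "location_solutions m r w d =
    {x \<in> location_feasible m r d. location_objective m r w x \<le> v}"
  using assms unfolding location_min_value_def location_solutions_def
  by (auto simp: is_arg_min_linorder) (meson order_trans)

theorem corollary6:
  fixes m :: nat and r :: "nat \<Rightarrow> real^2" and w d :: "nat \<Rightarrow> real"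
    and p1 p2 q1 q2 g1 g2 h1 h2 \<theta> :: real
  assumes "m \<ge> 1"
    and "\<And>j. j \<in> {1..m} \<Longrightarrow> d j \<ge> 0"
    and "p1 = (MAX j\<in>{1..m}. w j + r j $ 1 + r j $ 2)"
    and "p2 = (MAX j\<in>{1..m}. w j - r j $ 1 + r j $ 2)"
    and "q1 = (MIN j\<in>{1..m}. - w j + r j $ 1 + r j $ 2)"
    and "q2 = (MIN j\<in>{1..m}. - w j - r j $ 1 + r j $ 2)"
    and "g1 = (MAX j\<in>{1..m}. - d j + r j $ 1 + r j $ 2)"
    and "g2 = (MAX j\<in>{1..m}. - d j - r j $ 1 + r j $ 2)"
    and "h1 = (MIN j\<in>{1..m}. d j + r j $ 1 + r j $ 2)"
    and "h2 = (MIN j\<in>{1..m}. d j - r j $ 1 + r j $ 2)"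
    and "max (g1 - h1) (g2 - h2) \<le> 0"
    and "\<theta> = Max {(p1 - q1) / 2, (p2 - q2) / 2, p1 - h1, p2 - h2, g1 - q1, g2 - q2}"
  shows "location_min_value m r w d \<theta> \<and>
    location_solutions m r w d =
      {vector [(u1 - u2) / 2, (u1 + u2) / 2] | u1 u2 \<alpha>.
         0 \<le> \<alpha> \<and> \<alpha> \<le> 1 \<and>
         u1 = (1 - \<alpha>) * max g1 (p1 - \<theta>) + \<alpha> * min h1 (q1 + \<theta>) \<and>
         u2 = (1 - \<alpha>) * max g2 (p2 - \<theta>) + \<alpha> * min h2 (q2 + \<theta>)}"
proof -
  let ?F = "location_feasible m r d" and ?f = "location_objective m r w"
  let ?a1 = "max g1 (p1 - \<theta>)" and ?b1 = "min h1 (q1 + \<theta>)"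
  let ?a2 = "max g2 (p2 - \<theta>)" and ?b2 = "min h2 (q2 + \<theta>)"
  have J: "finite {1..m}" "{1..m} \<noteq> {}"
    using assms(1) by auto
  have feasible: "x \<in> ?F \<longleftrightarrow>
      g1 \<le> x $ 1 + x $ 2 \<and> x $ 1 + x $ 2 \<le> h1 \<and> g2 \<le> x $ 2 - x $ 1 \<and> x $ 2 - x $ 1 \<le> h2" for x
    unfolding location_feasible_def mem_Collect_eq Ball_rect_dist_le_iff[OF J] assms(7-10) ..
  have sublevel: "?f x \<le> v \<longleftrightarrow>
      p1 - v \<le> x $ 1 + x $ 2 \<and> x $ 1 + x $ 2 \<le> q1 + v \<and>
      p2 - v \<le> x $ 2 - x $ 1 \<and> x $ 2 - x $ 1 \<le> q2 + v" for x v
    unfolding location_objective_def Max_rect_dist_le_iff[OF J] assms(3-6) ..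
  have \<theta>_in: "\<theta> \<in> {(p1 - q1) / 2, (p2 - q2) / 2, p1 - h1, p2 - h2, g1 - q1, g2 - q2}"
    unfolding assms(12) by (rule Max_in) auto
  have \<theta>_le_iff: "\<theta> \<le> v \<longleftrightarrow> (p1 - q1) / 2 \<le> v \<and> (p2 - q2) / 2 \<le> v \<and>
      p1 - h1 \<le> v \<and> p2 - h2 \<le> v \<and> g1 - q1 \<le> v \<and> g2 - q2 \<le> v" for v
    unfolding assms(12) by (subst Max_le_iff) auto
  \<comment> \<open>Each inequality splits into four: \<open>g \<le> h\<close> is the consistency
    hypothesis, and the other three say that \<open>\<theta>\<close> bounds \<open>p - h\<close>,
    \<open>g - q\<close> and \<open>(p - q) / 2\<close>.\<close>
  have box: "?a1 \<le> ?b1" "?a2 \<le> ?b2"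
    using assms(11) \<theta>_le_iff[of \<theta>] by auto
  \<comment> \<open>Whichever of the six terms equals \<open>\<theta>\<close> makes a lower bound
    meet an upper bound: if \<open>\<theta> = p1 - h1\<close>, then
    \<open>p1 - \<theta> = h1\<close>, hence \<open>?b1 \<le> ?a1\<close>.\<close>
  have degenerate: "?a1 = ?b1 \<or> ?a2 = ?b2"
    using \<theta>_in box by (auto simp: max_def min_def split: if_splits)
  have optimal: "x \<in> ?F \<and> ?f x \<le> \<theta> \<longleftrightarrow>
      ?a1 \<le> x $ 1 + x $ 2 \<and> x $ 1 + x $ 2 \<le> ?b1 \<and> ?a2 \<le> x $ 2 - x $ 1 \<and> x $ 2 - x $ 1 \<le> ?b2" for x
    unfolding feasible sublevel by auto
  \<comment> \<open>A feasible \<open>x\<close> lies in the sublevel set of its own value, so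
    comparing lower with upper bounds on each coordinate gives all six inequalities.\<close>
  have lower: "\<theta> \<le> ?f x" if "x \<in> ?F" for x
    using that sublevel[of x "?f x"] unfolding feasible \<theta>_le_iff by (simp add: field_simps)
  \<comment> \<open>The corner of the optimal box at the lower ends, i.e. \<alpha> = 0, shows that
    \<open>\<theta>\<close> is attained.\<close>
  define z :: "real^2" where "z = vector [(?a1 - ?a2) / 2, (?a1 + ?a2) / 2]"
  have "z \<in> ?F \<and> ?f z \<le> \<theta>"
    using z_def[unfolded vector2_eq_rotated_iff] box unfolding optimal by (metis order_refl)
  with lower have min: "location_min_value m r w d \<theta>"
    unfolding location_min_value_def by (metis antisym image_eqI)
  have "x \<in> location_solutions m r w d \<longleftrightarrow>
      (\<exists>u1 u2 \<alpha>. x = vector [(u1 - u2) / 2, (u1 + u2) / 2] \<and> 0 \<le> \<alpha> \<and> \<alpha> \<le> 1 \<and>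
         u1 = (1 - \<alpha>) * ?a1 + \<alpha> * ?b1 \<and> u2 = (1 - \<alpha>) * ?a2 + \<alpha> * ?b2)" for x
    unfolding location_solutions_eq[OF min] mem_Collect_eq optimal vector2_eq_rotated_iff
      ex_convex_combination_degenerate_box_iff[OF box degenerate, symmetric]
    by (intro iffI; elim exE conjE; intro exI conjI; (assumption | simp only:))
  then show ?thesis
    using min by blast
qed

end
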